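(* Let $\mathcal H,\mathcal F$ be real Hilbert spaces, $A\in L(\mathcal H,\mathcal F)$, $b\in\mathcal F$, let $W\in L(\mathcal F)$ be positive semidefinite with $W^{1/2}\in S_2$, and let $\rho>0$. Let $$G(x)=\frac{\|Ax-b\|_W^2}{1+\|x\|^2}+\rho\|x\|^2,\quad x\in\mathcal H,\qquad t^*:=\inf_{x\in\mathcal H}G(x).$$ Then $t^*$ is the maximum of all $t\in\mathbb R$ for which there exist $\alpha,\beta\in\mathbb R$ such that the operator $C\in L(\mathcal H\times\mathbb R^3)$ defined by $$C:=\begin{pmatrix} \alpha A^*WA+\beta I & 0 & 0 & -\alpha A^*Wb\\ 0 & 0 & 0 & \frac{1-\alpha}{2}\\ 0 & 0 & \rho & \frac{\rho-t-\beta}{2}\\ \langle\cdot,-\alpha A^*Wb\rangle & \frac{1-\alpha}{2} & \frac{\rho-t-\beta}{2} & \alpha\|b\|_W^2-t \end{pmatrix}$$ is nonnegative.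
   Context: $L(\mathcal H,\mathcal F)$ denotes the bounded linear operators, $L(\mathcal H)=L(\mathcal H,\mathcal H)$. $S_2$ is the Hilbert–Schmidt class. $\|z\|_W:=\|W^{1/2}z\|$ for $z\in\mathcal F$. The block operator acts on $(x,z_1,z_2,z_3)\in\mathcal H\times\mathbb R\times\mathbb R\times\mathbb R$ with the product Hilbert space structure, where the entry $-\alpha A^*Wb$ denotes the map $z_3\mapsto -z_3\,\alpha A^*Wb$ and $\langle\cdot,-\alpha A^*Wb\rangle$ the functional $x\mapsto\langle x,-\alpha A^*Wb\rangle$. Nonnegative means $\langle Cy,y\rangle\ge0$ for all $y\in\mathcal H\times\mathbb R^3$. *)

theory Defs
  imports "HOL-Analysis.Analysis"
begin

text \<open>
  Real Hilbert spaces are types of sort \<open>{real_inner, complete_space}\<close>, not necessarily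
  separable, and \<open>L(H, F)\<close> is the type \<open>'h \<Rightarrow>\<^sub>L 'f\<close>.
\<close>

definition nonnegative_op :: "('a::real_inner \<Rightarrow>\<^sub>L 'a) \<Rightarrow> bool" where
  "nonnegative_op T \<longleftrightarrow> (\<forall>y. T y \<bullet> y \<ge> 0)"

text \<open>
  On a real space nonnegativity of the quadratic form does not imply self-adjointness, so positive
  semidefiniteness requires it separately.
\<close>

definition selfadjoint_op :: "('a::real_inner \<Rightarrow>\<^sub>L 'a) \<Rightarrow> bool" where
  "selfadjoint_op T \<longleftrightarrow> (\<forall>x y. T x \<bullet> y = x \<bullet> T y)"

definition psd_op :: "('a::real_inner \<Rightarrow>\<^sub>L 'a) \<Rightarrow> bool" where
  "psd_op T \<longleftrightarrow> selfadjoint_op T \<and> nonnegative_op T"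

text \<open>
  On a Hilbert space every positive semidefinite operator has exactly one positive semidefinite
  square root; the definite description is meaningful only in that case.
\<close>

definition sqrt_op :: "('a::{real_inner, complete_space} \<Rightarrow>\<^sub>L 'a) \<Rightarrow> ('a \<Rightarrow>\<^sub>L 'a)" where
  "sqrt_op W = (THE R. psd_op R \<and> R o\<^sub>L R = W)"

definition orthonormal_basis :: "'a::{real_inner, complete_space} set \<Rightarrow> bool" where
  "orthonormal_basis E \<longleftrightarrow>
     pairwise orthogonal E \<and> (\<forall>e\<in>E. norm e = 1) \<and> closure (span E) = UNIV"

text \<open>
  The sum of squares does not depend on the choice of the orthonormal basis, and an orthonormal
  basis always exists, so quantifying existentially or universally over bases is the same.
\<close>

definition hilbert_schmidt ::
    "('a::{real_inner, complete_space} \<Rightarrow>\<^sub>L 'b::{real_inner, complete_space}) \<Rightarrow> bool" where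
  "hilbert_schmidt T \<longleftrightarrow>
     (\<exists>E. orthonormal_basis E \<and> (\<lambda>e. (norm (T e))\<^sup>2) summable_on E)"

definition wnorm :: "('a::{real_inner, complete_space} \<Rightarrow>\<^sub>L 'a) \<Rightarrow> 'a \<Rightarrow> real" where
  "wnorm W z = norm (sqrt_op W z)"

definition objective ::
    "('h::{real_inner, complete_space} \<Rightarrow>\<^sub>L 'f::{real_inner, complete_space}) \<Rightarrow> 'f
      \<Rightarrow> ('f \<Rightarrow>\<^sub>L 'f) \<Rightarrow> real \<Rightarrow> 'h \<Rightarrow> real" where
  "objective A b W \<rho> x = (wnorm W (A x - b))\<^sup>2 / (1 + (norm x)\<^sup>2) + \<rho> * (norm x)\<^sup>2"

text \<open>
  The map below is bounded and linear because \<open>A\<close> has a bounded adjoint, so \<open>Blinfun\<close> is applied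
  within its domain. The product type carries the Hilbert space structure of the direct sum.
\<close>

definition block_op ::
    "('h::{real_inner, complete_space} \<Rightarrow>\<^sub>L 'f::{real_inner, complete_space}) \<Rightarrow> 'f
      \<Rightarrow> ('f \<Rightarrow>\<^sub>L 'f) \<Rightarrow> real \<Rightarrow> real \<Rightarrow> real \<Rightarrow> real
      \<Rightarrow> (('h \<times> real \<times> real \<times> real) \<Rightarrow>\<^sub>L ('h \<times> real \<times> real \<times> real))" where
  "block_op A b W \<rho> t \<alpha> \<beta> = Blinfun (\<lambda>(x, z1, z2, z3).
     (\<alpha> *\<^sub>R adjoint A (W (A x)) + \<beta> *\<^sub>R x + z3 *\<^sub>R (- (\<alpha> *\<^sub>R adjoint A (W b))),
      ((1 - \<alpha>) / 2) * z3,
      \<rho> * z2 + ((\<rho> - t - \<beta>) / 2) * z3,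
      x \<bullet> (- (\<alpha> *\<^sub>R adjoint A (W b))) + ((1 - \<alpha>) / 2) * z1 + ((\<rho> - t - \<beta>) / 2) * z2
        + (\<alpha> * (wnorm W b)\<^sup>2 - t) * z3))"

end

theory Submission
  imports Defs
begin

text \<open>
  Put \<open>L = W\<^sup>1\<^sup>/\<^sup>2 A\<close> and \<open>c = W\<^sup>1\<^sup>/\<^sup>2 b\<close>. The quadratic form of the block operator at
  \<open>(x, z1, z2, z3)\<close> is
  \<open>\<alpha> |L x - z3 c|\<^sup>2 + \<beta> |x|\<^sup>2 - t z3\<^sup>2 + (1 - \<alpha>) z1 z3 + \<rho> z2\<^sup>2 + (\<rho> - t - \<beta>) z2 z3\<close>
  (\<open>block_op_quadratic_form\<close>). It is affine in \<open>z1\<close>, so nonnegativity forces \<open>\<alpha> = 1\<close>. What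
  remains is homogeneous; at \<open>z3 = 1\<close> and \<open>z2 = s\<close> it reads
  \<open>|L x - c|\<^sup>2 + \<beta> (|x|\<^sup>2 - s) + (\<rho> s - t) (1 + s)\<close>, the Lagrangian of the problem in which
  \<open>s\<close> is a free variable subject to the constraint \<open>s = |x|\<^sup>2\<close>. On the constraint it equals
  \<open>(1 + |x|\<^sup>2) (G x - t)\<close>, so nonnegativity implies \<open>t \<le> G x\<close> for all \<open>x\<close>.

  Conversely a multiplier \<open>\<beta>\<close> is needed for \<open>t = inf G\<close> (\<open>multiplier_exists\<close>). Feasibility
  says that in the plane the points \<open>(|x|\<^sup>2, v)\<close> with \<open>v \<ge> |L x - c|\<^sup>2\<close> avoid the region strictly
  below the graph of the concave function \<open>s \<mapsto> - (\<rho> s - t) (1 + s)\<close>. If the first set is convex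
  as well, a line separates the two, and its slope is \<open>- \<beta>\<close>; the line is not vertical because the
  second region lies over the whole axis, so no constraint qualification enters. The convexity
  is hidden: the set is built from two quadratic functions of \<open>x\<close>, and both have to be controlled
  simultaneously. This is \<open>sphere_convex_combination\<close>, an elementary argument on the line
  through two points that works in every inner product space.

  The operator theory needed to read off the quadratic form is developed first: the adjoint comes
  from the Riesz representation theorem, and existence and uniqueness of the positive semidefinite
  square root come from an iteration that converges in operator norm.
\<close>

section \<open>Adjoints on Hilbert spaces\<close>

text \<open>
  The representing vector minimizes \<open>J x = |x|\<^sup>2 - 2 \<phi> x\<close>. The parallelogram identity makes every
  minimizing sequence Cauchy, and the first variation of \<open>J\<close> at the minimizer gives the formula.
\<close>

lemma riesz_representation:
  fixes \<phi> :: "'a::{real_inner, complete_space} \<Rightarrow> real"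
  assumes "bounded_linear \<phi>"
  obtains z where "\<And>x. \<phi> x = z \<bullet> x"
proof -
  interpret bounded_linear \<phi> by fact
  obtain K where K: "\<And>x. norm (\<phi> x) \<le> norm x * K" using bounded by blast
  define J where "J x = x \<bullet> x - 2 * \<phi> x" for x
  have lower: "J x \<ge> - K\<^sup>2" for x
  proof -
    have "\<phi> x \<le> norm x * K" using K[of x] by simp
    moreover have "0 \<le> (norm x - K)\<^sup>2" by simp
    ultimately show ?thesis
      unfolding J_def by (simp add: power2_diff power2_norm_eq_inner)
  qed
  define m where "m = (INF x. J x)"
  have bdd: "bdd_below (range J)" using lower by (intro bdd_belowI2)
  have m_le: "m \<le> J x" for x unfolding m_def by (rule cINF_lower[OF bdd]) simp
  have "\<exists>x. J x < m + 1 / real (Suc n)" for n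
    using cINF_less_iff[OF _ bdd, of "m + 1 / real (Suc n)"] by (simp add: m_def)
  then obtain X where X: "\<And>n. J (X n) < m + 1 / real (Suc n)" by metis
  have parallelogram: "(norm (x - y))\<^sup>2 \<le> 2 * (J x - m) + 2 * (J y - m)" for x y
  proof -
    have "(norm (x - y))\<^sup>2 = 2 * J x + 2 * J y - 4 * J ((1/2) *\<^sub>R (x + y))"
      unfolding J_def power2_norm_eq_inner
      by (simp add: scale add inner_simps inner_commute) (simp add: field_simps)
    then show ?thesis using m_le[of "(1/2) *\<^sub>R (x + y)"] by simp
  qed
  have "Cauchy X"
  proof (rule metric_CauchyI)
    fix e :: real assume "e > 0"
    then obtain N where N: "1 / real (Suc N) < e\<^sup>2 / 4"
      by (metis nat_approx_posE zero_less_divide_iff zero_less_numeral zero_less_power)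
    have small: "J (X n) - m < e\<^sup>2 / 4" if "n \<ge> N" for n
    proof -
      have "1 / real (Suc n) \<le> 1 / real (Suc N)" using that by (simp add: frac_le)
      then show ?thesis using X[of n] N by linarith
    qed
    have "dist (X k) (X n) < e" if "k \<ge> N" "n \<ge> N" for k n
    proof -
      have "(norm (X k - X n))\<^sup>2 < e\<^sup>2"
      proof -
        have "2 * (J (X k) - m) + 2 * (J (X n) - m) < 2 * (e\<^sup>2 / 4) + 2 * (e\<^sup>2 / 4)"
          by (intro add_strict_mono mult_strict_left_mono small that) auto
        then show ?thesis using parallelogram[of "X k" "X n"] by simp
      qed
      then show ?thesis using \<open>e > 0\<close> power_less_imp_less_base by (fastforce simp: dist_norm)
    qed
    then show "\<exists>M. \<forall>m\<ge>M. \<forall>n\<ge>M. dist (X m) (X n) < e" by blast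
  qed
  then obtain z where z: "X \<longlonglongrightarrow> z" by (auto simp: Cauchy_convergent_iff convergent_def)
  have "(\<lambda>n. J (X n)) \<longlonglongrightarrow> J z"
    unfolding J_def by (intro tendsto_intros z tendsto)
  moreover have "(\<lambda>n. m + 1 / real (Suc n)) \<longlonglongrightarrow> m + 0"
    by (intro tendsto_intros LIMSEQ_Suc[OF lim_1_over_n])
  ultimately have "J z \<le> m + 0"
    by (rule LIMSEQ_le) (use X less_imp_le in blast)
  then have min: "J z \<le> J y" for y using m_le[of y] by simp
  have "\<phi> x = z \<bullet> x" for x
  proof (rule ccontr)
    assume ne: "\<phi> x \<noteq> z \<bullet> x"
    \<comment> \<open>A short step along \<open>x\<close>, against the sign of the slope \<open>2 k\<close>, would decrease \<open>J\<close>; adding one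
      keeps \<open>N\<close> positive and the step \<open>- k / N\<close> short enough.\<close>
    define k where "k = z \<bullet> x - \<phi> x"
    define N where "N = x \<bullet> x + 1"
    have "N > 0" "k \<noteq> 0" using ne by (auto simp: N_def k_def add_nonneg_pos)
    have "J (z + s *\<^sub>R x) = J z + 2 * s * k + s\<^sup>2 * (N - 1)" for s
      unfolding J_def k_def N_def
      by (simp add: scale add inner_simps inner_commute algebra_simps power2_eq_square)
    from this[of "- k / N"] min[of "z + (- k / N) *\<^sub>R x"]
    have "0 \<le> 2 * (- k / N) * k + (- k / N)\<^sup>2 * (N - 1)" by linarith
    also have "\<dots> = - (k\<^sup>2 * (N + 1) / N\<^sup>2)"
      using \<open>N > 0\<close> by (simp add: field_simps power2_eq_square)
    also have "\<dots> < 0" using \<open>N > 0\<close> \<open>k \<noteq> 0\<close> by simp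
    finally show False by simp
  qed
  then show ?thesis using that by blast
qed

text \<open>
  The constant \<open>adjoint\<close> is a choice of any function with this property; completeness of the domain
  guarantees that one exists.
\<close>

lemma adjoint_blinfun:
  fixes A :: "'h::{real_inner, complete_space} \<Rightarrow>\<^sub>L 'f::real_inner"
  shows "x \<bullet> adjoint (blinfun_apply A) y = A x \<bullet> y"
proof -
  have "\<exists>z. \<forall>x. A x \<bullet> y = x \<bullet> z" for y
  proof -
    have "bounded_linear (\<lambda>x. A x \<bullet> y)"
      by (intro bounded_linear_inner_left_comp blinfun.bounded_linear_right)
    then obtain z where "\<And>x. A x \<bullet> y = z \<bullet> x" by (rule riesz_representation) blast
    then show ?thesis by (auto simp: inner_commute)
  qed
  then have "\<exists>f. \<forall>x y. A x \<bullet> y = x \<bullet> f y" by metis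
  then have "\<forall>x y. A x \<bullet> y = x \<bullet> adjoint (blinfun_apply A) y"
    unfolding adjoint_def by (rule someI_ex)
  then show ?thesis by simp
qed

lemma bounded_linear_adjoint_blinfun:
  fixes A :: "'h::{real_inner, complete_space} \<Rightarrow>\<^sub>L 'f::real_inner"
  shows "bounded_linear (adjoint (blinfun_apply A))"
proof (rule bounded_linear_intro[where K = "norm A"])
  let ?B = "adjoint (blinfun_apply A)"
  show "?B (x + y) = ?B x + ?B y" for x y
    by (rule vector_eq_ldot[THEN iffD1]) (simp add: inner_add_right adjoint_blinfun)
  show "?B (r *\<^sub>R x) = r *\<^sub>R ?B x" for r x
    by (rule vector_eq_ldot[THEN iffD1]) (simp add: adjoint_blinfun)
  show "norm (?B y) \<le> norm y * norm A" for y
  proof (cases "?B y = 0")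
    case False
    have "norm (?B y) * norm (?B y) = A (?B y) \<bullet> y"
      by (metis adjoint_blinfun power2_norm_eq_inner power2_eq_square)
    also have "\<dots> \<le> norm (A (?B y)) * norm y" by (rule norm_cauchy_schwarz)
    also have "\<dots> \<le> norm A * norm (?B y) * norm y"
      by (intro mult_right_mono norm_blinfun norm_ge_zero)
    finally show ?thesis using False by (simp add: mult_ac)
  qed simp
qed

section \<open>Square roots of positive semidefinite operators\<close>

text \<open>
  A fixed point \<open>Y\<close> of this iteration satisfies \<open>(I - Y)\<^sup>2 = I - B\<close>, so \<open>I - Y\<close> is a square root of
  \<open>I - B\<close>. The iterates are polynomials in \<open>B\<close>.
\<close>

primrec sqrt_iter :: "('a::real_inner \<Rightarrow>\<^sub>L 'a) \<Rightarrow> nat \<Rightarrow> ('a \<Rightarrow>\<^sub>L 'a)" where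
  "sqrt_iter B 0 = 0"
| "sqrt_iter B (Suc n) = (1/2) *\<^sub>R (B + (sqrt_iter B n o\<^sub>L sqrt_iter B n))"

text \<open>
  The same iteration for the number \<open>B = 1\<close>. Because the polynomials have nonnegative coefficients,
  it dominates the operator iteration for every contraction \<open>B\<close>.
\<close>

primrec sqrt_majorant :: "nat \<Rightarrow> real" where
  "sqrt_majorant 0 = 0"
| "sqrt_majorant (Suc n) = (1 + (sqrt_majorant n)\<^sup>2) / 2"

lemma sqrt_iter_commute:
  fixes S B :: "'a::real_inner \<Rightarrow>\<^sub>L 'a"
  assumes "\<And>x. S (B x) = B (S x)"
  shows "S (sqrt_iter B n x) = sqrt_iter B n (S x)"
proof (induction n arbitrary: x)
  case (Suc n)
  then show ?case by (simp add: blinfun.bilinear_simps assms)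
qed (simp add: blinfun.bilinear_simps)

lemma sqrt_iter_commute_iter:
  "sqrt_iter B m (sqrt_iter B n x) = sqrt_iter B n (sqrt_iter B m x)"
proof (rule sqrt_iter_commute)
  show "sqrt_iter B m (B x) = B (sqrt_iter B m x)" for x
    using sqrt_iter_commute[of B B m x] by simp
qed

lemma sqrt_iter_selfadjoint:
  assumes "selfadjoint_op B"
  shows "sqrt_iter B n x \<bullet> y = x \<bullet> sqrt_iter B n y"
proof (induction n arbitrary: x y)
  case (Suc n)
  then show ?case using assms sqrt_iter_commute[of B B n y]
    by (simp add: blinfun.bilinear_simps inner_simps selfadjoint_op_def)
qed simp

lemma sqrt_majorant_bounds: "0 \<le> sqrt_majorant n \<and> sqrt_majorant n \<le> 1"
proof (induction n)
  case (Suc n)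
  then have "(sqrt_majorant n)\<^sup>2 \<le> 1" by (simp add: abs_square_le_1)
  then show ?case by simp
qed simp

lemma sqrt_majorant_le_Suc: "sqrt_majorant n \<le> sqrt_majorant (Suc n)"
proof -
  have "0 \<le> (1 - sqrt_majorant n)\<^sup>2" by simp
  then show ?thesis by (simp add: power2_diff)
qed

lemma norm_sqrt_iter_le:
  assumes "norm B \<le> 1"
  shows "norm (sqrt_iter B n) \<le> sqrt_majorant n"
proof (induction n)
  case (Suc n)
  have "norm (B + (sqrt_iter B n o\<^sub>L sqrt_iter B n))
      \<le> norm B + norm (sqrt_iter B n) * norm (sqrt_iter B n)"
    by (rule order_trans[OF norm_triangle_ineq add_left_mono[OF norm_blinfun_compose]])
  also have "\<dots> \<le> 1 + sqrt_majorant n * sqrt_majorant n"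
    using assms Suc sqrt_majorant_bounds[of n] by (intro add_mono mult_mono) auto
  finally show ?case by (simp add: power2_eq_square)
qed simp

text \<open>
  The iterates commute, hence \<open>Y\<^sub>n\<^sub>+\<^sub>1\<^sup>2 - Y\<^sub>n\<^sup>2 = (Y\<^sub>n\<^sub>+\<^sub>1 + Y\<^sub>n) (Y\<^sub>n\<^sub>+\<^sub>1 - Y\<^sub>n)\<close>, and the corresponding
  factorization of the scalar majorant bounds both factors.
\<close>

lemma norm_sqrt_iter_step:
  assumes "norm B \<le> 1"
  shows "norm (sqrt_iter B (Suc n) - sqrt_iter B n) \<le> sqrt_majorant (Suc n) - sqrt_majorant n"
proof (induction n)
  case 0
  then show ?case using assms by simp
next
  case (Suc n)
  let ?Y = "sqrt_iter B" and ?y = sqrt_majorant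
  have "?Y (Suc (Suc n)) - ?Y (Suc n)
      = (1/2) *\<^sub>R ((?Y (Suc n) + ?Y n) o\<^sub>L (?Y (Suc n) - ?Y n))"
  proof (rule blinfun_eqI)
    fix x
    have rec: "?Y (Suc k) x = (1/2) *\<^sub>R (B x + ?Y k (?Y k x))" for k
      by (simp add: blinfun.bilinear_simps)
    have "?Y (Suc (Suc n)) x - ?Y (Suc n) x
        = (1/2) *\<^sub>R (B x + ?Y (Suc n) (?Y (Suc n) x)) - (1/2) *\<^sub>R (B x + ?Y n (?Y n x))"
      by (rule arg_cong2[where f = minus, OF rec rec])
    then show "(?Y (Suc (Suc n)) - ?Y (Suc n)) x
        = ((1/2) *\<^sub>R ((?Y (Suc n) + ?Y n) o\<^sub>L (?Y (Suc n) - ?Y n))) x"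
      using sqrt_iter_commute_iter[of B "Suc n" n x]
      by (simp del: sqrt_iter.simps add: blinfun.bilinear_simps scaleR_right_distrib scaleR_right_diff_distrib)
  qed
  then have "norm (?Y (Suc (Suc n)) - ?Y (Suc n))
      \<le> (1/2) * (norm (?Y (Suc n) + ?Y n) * norm (?Y (Suc n) - ?Y n))"
    using norm_blinfun_compose[of "?Y (Suc n) + ?Y n" "?Y (Suc n) - ?Y n"]
    by (simp del: sqrt_iter.simps)
  also have "\<dots> \<le> (1/2) * ((?y (Suc n) + ?y n) * (?y (Suc n) - ?y n))"
  proof -
    have "norm (?Y (Suc n) + ?Y n) \<le> ?y (Suc n) + ?y n"
      by (intro norm_triangle_le add_mono norm_sqrt_iter_le assms)
    then show ?thesis
      using Suc.IH sqrt_majorant_bounds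
      by (intro mult_left_mono mult_mono add_nonneg_nonneg) (auto simp del: sqrt_iter.simps sqrt_majorant.simps)
  qed
  also have "\<dots> = ?y (Suc (Suc n)) - ?y (Suc n)"
    by (simp only: sqrt_majorant.simps(2)[of "Suc n"])
      (simp add: field_simps power2_eq_square)
  finally show ?case .
qed

lemma norm_sqrt_iter_diff:
  assumes "norm B \<le> 1"
  shows "norm (sqrt_iter B m - sqrt_iter B n) \<le> \<bar>sqrt_majorant m - sqrt_majorant n\<bar>"
proof -
  have *: "norm (sqrt_iter B (n + k) - sqrt_iter B n) \<le> sqrt_majorant (n + k) - sqrt_majorant n"
    for n k
  proof (induction k)
    case (Suc k)
    have "norm (sqrt_iter B (n + Suc k) - sqrt_iter B n)
        \<le> norm (sqrt_iter B (Suc (n + k)) - sqrt_iter B (n + k)) + norm (sqrt_iter B (n + k) - sqrt_iter B n)"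
      using norm_triangle_ineq[of "sqrt_iter B (Suc (n + k)) - sqrt_iter B (n + k)"
          "sqrt_iter B (n + k) - sqrt_iter B n"]
      by (simp del: sqrt_iter.simps)
    then show ?case using Suc norm_sqrt_iter_step[OF assms, of "n + k"]
      by (simp del: sqrt_iter.simps sqrt_majorant.simps)
  qed simp
  show ?thesis
    using *[of n "m - n"] *[of m "n - m"]
    by (cases "n \<le> m") (auto simp: norm_minus_commute)
qed

text \<open>
  The bounded increasing majorant is Cauchy, so the iterates are uniformly Cauchy on bounded sets;
  completeness is applied pointwise, at each vector. Uniform contractivity of the iterates is what
  allows the limit to be taken in \<open>Y\<^sub>n (Y\<^sub>n x)\<close>.
\<close>

lemma sqrt_iter_limit:
  fixes B :: "'a::{real_inner, complete_space} \<Rightarrow>\<^sub>L 'a"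
  assumes "norm B \<le> 1"
  obtains Y :: "'a \<Rightarrow>\<^sub>L 'a" where "norm Y \<le> 1" and "\<And>x. (\<lambda>n. sqrt_iter B n x) \<longlonglongrightarrow> blinfun_apply Y x"
    and "\<And>x. 2 *\<^sub>R Y x = B x + Y (Y x)"
proof -
  have inc: "incseq sqrt_majorant" by (rule incseq_SucI) (rule sqrt_majorant_le_Suc)
  have "Bseq sqrt_majorant" using sqrt_majorant_bounds by (intro BseqI'[where K = 1]) auto
  then have "convergent sqrt_majorant" by (rule Bseq_monoseq_convergent) (rule incseq_imp_monoseq[OF inc])
  then have Cy: "Cauchy sqrt_majorant" by (rule convergent_Cauchy)
  have "Cauchy (\<lambda>n. sqrt_iter B n x)" for x
  proof (rule metric_CauchyI)
    fix e :: real assume "e > 0"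
    then have "e / (norm x + 1) > 0" by (simp add: add_nonneg_pos)
    then obtain M where M: "\<And>m n. m \<ge> M \<Longrightarrow> n \<ge> M \<Longrightarrow>
        dist (sqrt_majorant m) (sqrt_majorant n) < e / (norm x + 1)"
      using metric_CauchyD[OF Cy] by blast
    have "dist (sqrt_iter B m x) (sqrt_iter B n x) < e" if "m \<ge> M" "n \<ge> M" for m n
    proof -
      have "dist (sqrt_iter B m x) (sqrt_iter B n x) = norm ((sqrt_iter B m - sqrt_iter B n) x)"
        by (simp add: dist_norm blinfun.diff_left)
      also have "\<dots> \<le> norm (sqrt_iter B m - sqrt_iter B n) * norm x" by (rule norm_blinfun)
      also have "\<dots> \<le> \<bar>sqrt_majorant m - sqrt_majorant n\<bar> * (norm x + 1)"
        using norm_sqrt_iter_diff[OF assms] by (intro mult_mono) auto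
      also have "\<dots> < e"
        using M[OF that] by (simp add: dist_real_def pos_less_divide_eq add_nonneg_pos)
      finally show ?thesis .
    qed
    then show "\<exists>M. \<forall>m\<ge>M. \<forall>n\<ge>M. dist (sqrt_iter B m x) (sqrt_iter B n x) < e" by blast
  qed
  then have "\<exists>y. (\<lambda>n. sqrt_iter B n x) \<longlonglongrightarrow> y" for x
    by (simp add: Cauchy_convergent_iff convergent_def)
  then obtain Z where Z: "\<And>x. (\<lambda>n. sqrt_iter B n x) \<longlonglongrightarrow> Z x" by metis
  have contr: "norm (sqrt_iter B n x) \<le> norm x" for n x
  proof -
    have "norm (sqrt_iter B n x) \<le> norm (sqrt_iter B n) * norm x" by (rule norm_blinfun)
    also have "\<dots> \<le> 1 * norm x"
      using norm_sqrt_iter_le[OF assms, of n] sqrt_majorant_bounds[of n]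
      by (intro mult_right_mono) auto
    finally show ?thesis by simp
  qed
  have contrZ: "norm (Z x) \<le> norm x" for x
    using tendsto_norm[OF Z[of x]] by (rule LIMSEQ_le_const2) (use contr in blast)
  have "bounded_linear Z"
  proof (rule bounded_linear_intro[where K = 1])
    show "Z (x + y) = Z x + Z y" for x y
      using LIMSEQ_unique[OF Z[of "x + y"]] tendsto_add[OF Z[of x] Z[of y]]
      by (simp add: blinfun.bilinear_simps)
    show "Z (r *\<^sub>R x) = r *\<^sub>R Z x" for r x
      using LIMSEQ_unique[OF Z[of "r *\<^sub>R x"]] tendsto_scaleR[OF tendsto_const Z[of x], of r]
      by (simp add: blinfun.bilinear_simps)
    show "norm (Z x) \<le> norm x * 1" for x using contrZ by simp
  qed
  then obtain Y where Y: "Z = blinfun_apply Y" by (metis bounded_linear_Blinfun_apply)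
  show ?thesis
  proof
    show "norm Y \<le> 1" using contrZ by (intro norm_blinfun_bound) (auto simp: Y)
    show lim: "(\<lambda>n. sqrt_iter B n x) \<longlonglongrightarrow> Y x" for x using Z by (simp add: Y)
    show "2 *\<^sub>R Y x = B x + Y (Y x)" for x
    proof -
      have "(\<lambda>n. sqrt_iter B n (sqrt_iter B n x) - sqrt_iter B n (Y x)) \<longlonglongrightarrow> 0"
      proof (rule Lim_null_comparison)
        show "\<forall>\<^sub>F n in sequentially. norm (sqrt_iter B n (sqrt_iter B n x) - sqrt_iter B n (Y x))
            \<le> norm (sqrt_iter B n x - Y x)"
          by (simp add: contr flip: blinfun.diff_right)
        show "(\<lambda>n. norm (sqrt_iter B n x - Y x)) \<longlonglongrightarrow> 0"
          using lim[of x] by (simp add: LIM_zero tendsto_norm_zero)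
      qed
      from tendsto_add[OF this lim[of "Y x"]]
      have "(\<lambda>n. sqrt_iter B n (sqrt_iter B n x)) \<longlonglongrightarrow> Y (Y x)" by simp
      then have "(\<lambda>n. (1/2) *\<^sub>R (B x + sqrt_iter B n (sqrt_iter B n x))) \<longlonglongrightarrow> (1/2) *\<^sub>R (B x + Y (Y x))"
        by (intro tendsto_scaleR tendsto_add tendsto_const)
      then have "(\<lambda>n. sqrt_iter B (Suc n) x) \<longlonglongrightarrow> (1/2) *\<^sub>R (B x + Y (Y x))"
        by (simp add: blinfun.bilinear_simps)
      with LIMSEQ_Suc[OF lim[of x]] have "Y x = (1/2) *\<^sub>R (B x + Y (Y x))"
        by (rule LIMSEQ_unique)
      then have "2 *\<^sub>R Y x = 2 *\<^sub>R ((1/2) *\<^sub>R (B x + Y (Y x)))" by simp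
      then show ?thesis by simp
    qed
  qed
qed

text \<open>
  This replaces the Cauchy-Schwarz inequality for the form \<open>W x \<bullet> y\<close>: expand the nonnegative value
  of the form at \<open>c x - W x\<close>.
\<close>

lemma psd_op_norm_square_le:
  assumes "psd_op W" "norm W \<le> c" "c > 0"
  shows "(norm (W x))\<^sup>2 \<le> c * (W x \<bullet> x)"
proof -
  let ?u = "W x"
  have sa: "\<And>x y. W x \<bullet> y = x \<bullet> W y" and nn: "\<And>x. 0 \<le> W x \<bullet> x"
    using assms(1) by (auto simp: psd_op_def selfadjoint_op_def nonnegative_op_def)
  have "W ?u \<bullet> ?u \<le> norm (W ?u) * norm ?u" by (rule norm_cauchy_schwarz)
  also have "\<dots> \<le> (c * norm ?u) * norm ?u"
    using norm_blinfun[of W ?u] mult_right_mono[OF assms(2), of "norm ?u"]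
    by (intro mult_right_mono) auto
  finally have 1: "W ?u \<bullet> ?u \<le> c * (norm ?u)\<^sup>2" by (simp add: power2_eq_square mult_ac)
  have "0 \<le> W (c *\<^sub>R x - ?u) \<bullet> (c *\<^sub>R x - ?u)" by (rule nn)
  also have "\<dots> = c\<^sup>2 * (?u \<bullet> x) - 2 * c * (norm ?u)\<^sup>2 + W ?u \<bullet> ?u"
    using sa[of ?u x]
    by (simp add: blinfun.bilinear_simps inner_simps power2_norm_eq_inner)
      (simp add: algebra_simps power2_eq_square inner_commute)
  finally have "c * (norm ?u)\<^sup>2 \<le> c * (c * (?u \<bullet> x))"
    using 1 by (simp add: power2_eq_square algebra_simps)
  then show ?thesis using assms(3) by simp
qed

lemma psd_op_kernel:
  assumes "psd_op W" "W x \<bullet> x = 0"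
  shows "W x = 0"
proof -
  have "norm W + 1 > 0" by (simp add: add_nonneg_pos)
  then have "(norm (W x))\<^sup>2 \<le> (norm W + 1) * (W x \<bullet> x)"
    by (intro psd_op_norm_square_le[OF assms(1)]) auto
  then show ?thesis using assms(2) by simp
qed

text \<open>
  After scaling, \<open>B = I - W / c\<close> is a contraction and the iteration applies. The commutation property
  passes from \<open>W\<close> to \<open>B\<close>, to all iterates and to their limit; it is what uniqueness rests on.
\<close>

lemma psd_op_sqrt_exists_commuting:
  fixes W :: "'a::{real_inner, complete_space} \<Rightarrow>\<^sub>L 'a"
  assumes "psd_op W"
  obtains R :: "'a \<Rightarrow>\<^sub>L 'a" where "psd_op R" and "R o\<^sub>L R = W"
    and "\<And>S z. (\<And>x. blinfun_apply S (W x) = W (S x)) \<Longrightarrow> S (R z) = R (S z)"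
proof -
  have sa: "\<And>x y. W x \<bullet> y = x \<bullet> W y" and nn: "\<And>x. 0 \<le> W x \<bullet> x"
    using assms by (auto simp: psd_op_def selfadjoint_op_def nonnegative_op_def)
  define c where "c = norm W + 1"
  have c: "c > 0" "norm W \<le> c" by (auto simp: c_def add_nonneg_pos)
  define B where "B = id_blinfun - (1/c) *\<^sub>R W"
  have B: "B x = x - (1/c) *\<^sub>R W x" for x
    by (simp add: B_def blinfun.bilinear_simps)
  have "norm B \<le> 1"
  proof (rule norm_blinfun_bound)
    fix x
    have "(norm (B x))\<^sup>2 = (norm x)\<^sup>2 - (2/c) * (W x \<bullet> x) + (norm (W x))\<^sup>2 / c\<^sup>2"
      unfolding B power2_norm_eq_inner
      by (simp add: inner_simps inner_commute power2_eq_square)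
    also have "(norm (W x))\<^sup>2 / c\<^sup>2 \<le> (1/c) * (W x \<bullet> x)"
      using psd_op_norm_square_le[OF assms c(2,1), of x] c(1)
      by (simp add: field_simps power2_eq_square)
    finally have "(norm (B x))\<^sup>2 \<le> (norm x)\<^sup>2 - (1/c) * (W x \<bullet> x)" by simp
    also have "\<dots> \<le> (norm x)\<^sup>2" using nn[of x] c(1) by simp
    finally show "norm (B x) \<le> 1 * norm x" using power2_le_imp_le by auto
  qed simp
  then obtain Y where Y1: "norm Y \<le> 1"
    and lim: "\<And>x. (\<lambda>n. sqrt_iter B n x) \<longlonglongrightarrow> blinfun_apply Y x"
    and eq: "\<And>x. 2 *\<^sub>R Y x = B x + Y (Y x)"
    using sqrt_iter_limit by blast
  have "selfadjoint_op B" using sa by (simp add: selfadjoint_op_def B inner_simps)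
  then have Ysa: "Y x \<bullet> y = x \<bullet> Y y" for x y
    using LIMSEQ_unique[OF tendsto_inner[OF lim tendsto_const]] tendsto_inner[OF tendsto_const lim]
    by (simp add: sqrt_iter_selfadjoint)
  have Yle: "Y x \<bullet> x \<le> x \<bullet> x" for x
  proof -
    have "Y x \<bullet> x \<le> norm (Y x) * norm x" by (rule norm_cauchy_schwarz)
    also have "\<dots> \<le> norm x * norm x"
      using norm_blinfun[of Y x] mult_right_mono[OF Y1, of "norm x"]
      by (intro mult_right_mono) auto
    finally show ?thesis by (simp add: dot_square_norm power2_eq_square)
  qed
  define R where "R = sqrt c *\<^sub>R (id_blinfun - Y)"
  have R: "R x = sqrt c *\<^sub>R (x - Y x)" for x
    by (simp add: R_def blinfun.bilinear_simps)
  show ?thesis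
  proof
    show "psd_op R"
      using Ysa Yle c(1)
      by (simp add: psd_op_def selfadjoint_op_def nonnegative_op_def R inner_simps)
    show "R o\<^sub>L R = W"
    proof (rule blinfun_eqI)
      fix x
      have "R (R x) = c *\<^sub>R (x - 2 *\<^sub>R Y x + Y (Y x))"
        using c(1) by (simp add: R blinfun.bilinear_simps algebra_simps scaleR_2)
      also have "\<dots> = W x"
        using c(1) by (simp add: eq B)
      finally show "(R o\<^sub>L R) x = W x" by simp
    qed
    show "S (R x) = R (S x)" if S: "\<And>x. blinfun_apply S (W x) = W (S x)" for S x
    proof -
      have "S (B x) = B (S x)" for x by (simp add: B blinfun.bilinear_simps S)
      then have "(\<lambda>n. S (sqrt_iter B n x)) \<longlonglongrightarrow> Y (S x)"
        using lim[of "S x"] by (simp add: sqrt_iter_commute)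
      moreover have "(\<lambda>n. S (sqrt_iter B n x)) \<longlonglongrightarrow> S (Y x)"
        by (rule blinfun.tendsto[OF tendsto_const lim])
      ultimately have "S (Y x) = Y (S x)" by (rule LIMSEQ_unique[rotated])
      then show ?thesis by (simp add: R blinfun.bilinear_simps)
    qed
  qed
qed

text \<open>
  With \<open>y = R x - S x\<close> one has \<open>(R + S) y = (R\<^sup>2 - S\<^sup>2) x = 0\<close>. Both forms are nonnegative at \<open>y\<close> and
  add up to zero, so \<open>R y = S y = 0\<close> and \<open>|y|\<^sup>2 = x \<bullet> (R - S) y\<close> vanishes.
\<close>

lemma commuting_psd_sqrt_unique:
  fixes R S :: "'a::real_inner \<Rightarrow>\<^sub>L 'a"
  assumes "psd_op R" "psd_op S" and sq: "R o\<^sub>L R = S o\<^sub>L S"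
    and comm: "\<And>x. S (R x) = R (S x)"
  shows "R = S"
proof (rule blinfun_eqI)
  fix x
  have RR: "R (R z) = S (S z)" for z using arg_cong[OF sq, of "\<lambda>T. T z"] by simp
  define y where "y = R x - S x"
  have nnR: "0 \<le> R y \<bullet> y" and nnS: "0 \<le> S y \<bullet> y"
    using assms by (auto simp: psd_op_def nonnegative_op_def)
  have "R y + S y = 0" unfolding y_def by (simp add: blinfun.bilinear_simps comm RR)
  then have "R y \<bullet> y + S y \<bullet> y = 0" by (metis inner_add_left inner_zero_left)
  then have "R y = 0" "S y = 0"
    using nnR nnS psd_op_kernel[OF assms(1)] psd_op_kernel[OF assms(2)] by auto
  have "y \<bullet> y = R x \<bullet> y - S x \<bullet> y" by (simp add: y_def inner_diff_left)
  also have "\<dots> = x \<bullet> R y - x \<bullet> S y"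
    using assms by (simp add: psd_op_def selfadjoint_op_def)
  finally show "R x = S x" using \<open>R y = 0\<close> \<open>S y = 0\<close> by (simp add: y_def)
qed

lemma sqrt_op_works:
  assumes "psd_op W"
  shows "psd_op (sqrt_op W)" "sqrt_op W o\<^sub>L sqrt_op W = W"
proof -
  obtain R where R: "psd_op R" "R o\<^sub>L R = W"
    and comm: "\<And>S z. (\<And>x. blinfun_apply S (W x) = W (S x)) \<Longrightarrow> S (R z) = R (S z)"
    using psd_op_sqrt_exists_commuting[OF assms] by blast
  have "\<exists>!R. psd_op R \<and> R o\<^sub>L R = W"
  proof (rule ex1I[of _ R])
    fix S assume S: "psd_op S \<and> S o\<^sub>L S = W"
    \<comment> \<open>Any square root \<open>S\<close> commutes with \<open>W = S\<^sup>2\<close>, hence with \<open>R\<close>.\<close>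
    then have "S (W x) = W (S x)" for x by (metis blinfun_apply_blinfun_compose)
    then show "S = R"
      using commuting_psd_sqrt_unique[of R S] comm R S by auto
  qed (use R in blast)
  then have "psd_op (sqrt_op W) \<and> sqrt_op W o\<^sub>L sqrt_op W = W"
    unfolding sqrt_op_def by (rule theI')
  then show "psd_op (sqrt_op W)" "sqrt_op W o\<^sub>L sqrt_op W = W" by auto
qed

lemma sqrt_op_inner:
  assumes "psd_op W"
  shows "sqrt_op W x \<bullet> sqrt_op W y = W x \<bullet> y"
proof -
  have "sqrt_op W x \<bullet> sqrt_op W y = (sqrt_op W o\<^sub>L sqrt_op W) x \<bullet> y"
    using sqrt_op_works(1)[OF assms] by (simp add: psd_op_def selfadjoint_op_def)
  then show ?thesis by (simp add: sqrt_op_works(2)[OF assms])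
qed

section \<open>Strong duality\<close>

text \<open>
  Convexity makes both functions too small at \<open>m = u x + v y\<close>: the squared norm by
  \<open>u v |x - y|\<^sup>2\<close>, the squared residual by \<open>u v |L (x - y)|\<^sup>2\<close>. Moving from \<open>m\<close> along \<open>d = x - y\<close>, the norm
  reaches the required value at two parameters \<open>p > 0 > q\<close> with \<open>p q = - u v\<close>. At both of them the
  excess of the residual is the parameter times one and the same number, so it is nonpositive at
  one of the two.
\<close>

lemma sphere_convex_combination:
  fixes L :: "'a::real_inner \<Rightarrow> 'b::real_inner"
  assumes "linear L" and uv: "0 \<le> u" "0 \<le> v" "u + v = 1"
  obtains w where "(norm w)\<^sup>2 = u * (norm x)\<^sup>2 + v * (norm y)\<^sup>2"
    and "(norm (L w - c))\<^sup>2 \<le> u * (norm (L x - c))\<^sup>2 + v * (norm (L y - c))\<^sup>2"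
proof (cases "x = y \<or> u = 0 \<or> v = 0")
  case True
  then consider "x = y" | "u = 0" "v = 1" | "v = 0" "u = 1" using uv by fastforce
  then show ?thesis
  proof cases
    case 1
    then show ?thesis using that[of x] uv(3) by (simp flip: distrib_right)
  next
    case 2 then show ?thesis using that[of y] by simp
  next
    case 3 then show ?thesis using that[of x] by simp
  qed
next
  case False
  interpret linear L by fact
  define d m \<mu> where "d = x - y" and "m = u *\<^sub>R x + v *\<^sub>R y" and "\<mu> = u * v"
  define N e where "N = d \<bullet> d" and "e = m \<bullet> d"
  define K g where "K = L d \<bullet> L d" and "g = (L m - c) \<bullet> L d"
  have \<mu>: "\<mu> > 0" and N: "N > 0"
    using False uv by (auto simp: \<mu>_def N_def d_def)
  have v: "v = 1 - u" using uv by simp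
  have nrm: "(norm (m + s *\<^sub>R d))\<^sup>2 = u * (norm x)\<^sup>2 + v * (norm y)\<^sup>2 + (N * (s\<^sup>2 - \<mu>) + 2 * e * s)" for s
    unfolding power2_norm_eq_inner N_def e_def \<mu>_def m_def d_def v
    by (simp add: inner_simps inner_commute power2_eq_square) (simp add: algebra_simps)
  have Lm: "L m = u *\<^sub>R L x + v *\<^sub>R L y" and Ld: "L d = L x - L y"
    by (simp_all add: m_def d_def add diff scale)
  have obj: "(norm (L (m + s *\<^sub>R d) - c))\<^sup>2
      = u * (norm (L x - c))\<^sup>2 + v * (norm (L y - c))\<^sup>2 + (K * (s\<^sup>2 - \<mu>) + 2 * g * s)" for s
    unfolding power2_norm_eq_inner K_def g_def \<mu>_def add scale Lm Ld v
    by (simp add: inner_simps inner_commute power2_eq_square) (simp add: algebra_simps)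
  define D where "D = e\<^sup>2 + N\<^sup>2 * \<mu>"
  have "sqrt D > \<bar>e\<bar>" unfolding D_def using N \<mu> by (intro real_less_rsqrt) simp
  define p where "p = (- e + sqrt D) / N"
  have p: "p > 0" using \<open>sqrt D > \<bar>e\<bar>\<close> N by (simp add: p_def)
  have sqD: "(sqrt D)\<^sup>2 = D" using N \<mu> by (simp add: D_def)
  have root_p: "N * (p\<^sup>2 - \<mu>) + 2 * e * p = 0"
  proof -
    have "N * p + e = sqrt D" using N by (simp add: p_def)
    then have "(N * p + e)\<^sup>2 = e\<^sup>2 + N\<^sup>2 * \<mu>" using sqD D_def by simp
    then have "N * (N * (p\<^sup>2 - \<mu>) + 2 * e * p) = 0" by (simp add: power2_eq_square algebra_simps)
    then show ?thesis using N by simp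
  qed
  define q where "q = - \<mu> / p"
  have q: "q < 0" using \<mu> p by (simp add: q_def)
  have pq: "p * q = - \<mu>" using p by (simp add: q_def)
  have sum: "N * (p + q) + 2 * e = 0"
  proof -
    have "p * (N * (p + q) + 2 * e) = N * (p\<^sup>2 + p * q) + 2 * e * p"
      by (simp add: power2_eq_square algebra_simps)
    also have "\<dots> = 0" using root_p pq by simp
    finally show ?thesis using p by simp
  qed
  \<comment> \<open>At \<open>p\<close> and \<open>q\<close> a quadratic with leading coefficient \<open>X\<close> and value \<open>- X \<mu>\<close> at zero, as both
    excesses are, is the parameter times a number that does not depend on which one is taken.\<close>
  have fac: "X * (s\<^sup>2 - \<mu>) + 2 * Z * s = s * (X * (p + q) + 2 * Z)" if "s = p \<or> s = q" for X Z s
  proof -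
    have "\<mu> = - (p * q)" using pq by simp
    then show ?thesis using that by (auto simp: power2_eq_square algebra_simps)
  qed
  define s where "s = (if K * (p + q) + 2 * g \<le> 0 then p else q)"
  have s: "s = p \<or> s = q" by (simp add: s_def)
  have "s * (K * (p + q) + 2 * g) \<le> 0"
    using p q by (auto simp: s_def mult_le_0_iff)
  then show ?thesis
    using that[of "m + s *\<^sub>R d"] nrm[of s] obj[of s] fac[OF s, of N e] fac[OF s, of K g] sum by simp
qed

text \<open>
  The lower boundary of this planar set is the value function
  \<open>r \<mapsto> inf {|L x - c|\<^sup>2 | |x|\<^sup>2 = r}\<close> of a least squares problem on spheres, whose convexity is
  remarkable because spheres are not convex.
\<close>

lemma convex_norm_residual_epigraph:
  fixes L :: "'a::real_inner \<Rightarrow> 'b::real_inner"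
  assumes "linear L"
  shows "convex {(r, v) | r v. \<exists>x. r = (norm x)\<^sup>2 \<and> (norm (L x - c))\<^sup>2 \<le> v}"
proof (rule convexI, clarsimp)
  fix u v :: real and r1 r2 x y
  assume uv: "0 \<le> u" "0 \<le> v" "u + v = 1"
    and le: "(norm (L x - c))\<^sup>2 \<le> r1" "(norm (L y - c))\<^sup>2 \<le> r2"
  obtain w where w: "(norm w)\<^sup>2 = u * (norm x)\<^sup>2 + v * (norm y)\<^sup>2"
    and "(norm (L w - c))\<^sup>2 \<le> u * (norm (L x - c))\<^sup>2 + v * (norm (L y - c))\<^sup>2"
    by (rule sphere_convex_combination[OF assms uv])
  moreover have "u * (norm (L x - c))\<^sup>2 + v * (norm (L y - c))\<^sup>2 \<le> u * r1 + v * r2"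
    using le uv by (intro add_mono mult_left_mono)
  ultimately show "\<exists>w. u * (norm x)\<^sup>2 + v * (norm y)\<^sup>2 = (norm w)\<^sup>2
      \<and> (norm (L w - c))\<^sup>2 \<le> u * r1 + v * r2"
    by (intro exI[of _ w]) simp
qed

text \<open>
  Lossless Lagrangian relaxation of the equality constraint \<open>s = |x|\<^sup>2\<close>, an instance of the S-lemma,
  by separating two convex sets in the plane.
\<close>

lemma multiplier_exists:
  fixes L :: "'a::real_inner \<Rightarrow> 'b::real_inner"
  assumes "linear L" and "\<rho> \<ge> 0"
    and feas: "\<And>x. 0 \<le> (norm (L x - c))\<^sup>2 + (\<rho> * (norm x)\<^sup>2 - t) * (1 + (norm x)\<^sup>2)"
  obtains \<beta> where "\<And>x s. 0 \<le> (norm (L x - c))\<^sup>2 + \<beta> * ((norm x)\<^sup>2 - s) + (\<rho> * s - t) * (1 + s)"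
proof -
  define p where "p s = (\<rho> * s - t) * (1 + s)" for s
  define S where "S = {(r, v) | r v. \<exists>x. r = (norm x)\<^sup>2 \<and> (norm (L x - c))\<^sup>2 \<le> v}"
  define T where "T = {(s, v) | s v. v < - p s}"
  have SI: "((norm x)\<^sup>2, v) \<in> S" if "(norm (L x - c))\<^sup>2 \<le> v" for x v using that by (auto simp: S_def)
  have TI: "(s, v) \<in> T" if "v < - p s" for s v using that by (auto simp: T_def)
  have "convex S" unfolding S_def by (rule convex_norm_residual_epigraph) fact
  moreover have "convex T"
  proof (rule convexI, clarsimp simp: T_def)
    fix u v s1 v1 s2 v2 :: real
    assume uv: "0 \<le> u" "0 \<le> v" "u + v = 1" and lt: "v1 < - p s1" "v2 < - p s2"
    have u: "u = 1 - v" using uv by simp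
    have "p (u * s1 + v * s2) = u * p s1 + v * p s2 - \<rho> * (u * v) * (s1 - s2)\<^sup>2"
      unfolding p_def u by algebra
    also have "\<dots> \<le> u * p s1 + v * p s2" using uv assms(2) by simp
    also have "\<dots> < - (u * v1 + v * v2)"
    proof -
      have "u * (- v1 - p s1) + v * (- v2 - p s2) > 0"
        using uv lt by (cases "u = 0") (auto intro: add_pos_nonneg)
      then show ?thesis by (simp add: algebra_simps)
    qed
    finally show "u * v1 + v * v2 < - p (u * s1 + v * s2)" by simp
  qed
  moreover have "S \<noteq> {}" "T \<noteq> {}" using SI[of 0, OF order_refl] TI[of "- p 0 - 1" 0] by auto
  moreover have "S \<inter> T = {}"
  proof -
    have False if "(norm (L x - c))\<^sup>2 \<le> v" "v < - p ((norm x)\<^sup>2)" for x v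
      using feas[of x] that by (simp add: p_def)
    then show ?thesis by (auto simp: S_def T_def)
  qed
  ultimately obtain a b where "a \<noteq> 0" and S: "\<forall>x\<in>S. a \<bullet> x \<le> b" and T: "\<forall>x\<in>T. b \<le> a \<bullet> x"
    using separating_hyperplane_sets[of S T] by blast
  obtain a1 a2 where a: "a = (a1, a2)" by (cases a)
  have S': "a1 * (norm x)\<^sup>2 + a2 * v \<le> b" if "(norm (L x - c))\<^sup>2 \<le> v" for x v
    using S SI[OF that] by (auto simp: a)
  have T': "b \<le> a1 * s + a2 * v" if "v < - p s" for s v using T TI[OF that] by (auto simp: a)
  \<comment> \<open>\<open>T\<close> is unbounded below, and it meets every vertical line; so the normal points downwards.\<close>
  have "\<not> a2 > 0"
  proof
    assume pos: "a2 > 0"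
    define v where "v = min (- p 0 - 1) ((b - 1) / a2)"
    have "a2 * v \<le> a2 * ((b - 1) / a2)" using pos by (intro mult_left_mono) (auto simp: v_def)
    moreover have "v < - p 0" by (simp add: v_def min_def)
    ultimately show False using T'[of v 0] pos by simp
  qed
  moreover have "a2 \<noteq> 0"
  proof
    assume "a2 = 0"
    then have "a1 \<noteq> 0" using \<open>a \<noteq> 0\<close> a by (simp add: zero_prod_def)
    then show False using T'[of "- p ((b - 1) / a1) - 1" "(b - 1) / a1"] \<open>a2 = 0\<close> by simp
  qed
  ultimately have neg: "a2 < 0" by simp
  show ?thesis
  proof
    fix x s
    define \<beta> where "\<beta> = a1 / a2"
    have a1: "a1 = a2 * \<beta>" using neg by (simp add: \<beta>_def)
    have "a2 * (\<beta> * (norm x)\<^sup>2 + (norm (L x - c))\<^sup>2) \<le> b"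
      using S'[OF order_refl, of x] by (simp add: a1 algebra_simps)
    moreover have "b \<le> a2 * (\<beta> * s - p s)"
    proof (rule field_le_epsilon)
      fix e :: real assume "e > 0"
      then have "- p s + e / a2 < - p s" using neg by (simp add: divide_pos_neg)
      from T'[OF this] show "b \<le> a2 * (\<beta> * s - p s) + e"
        using neg by (simp add: a1 algebra_simps)
    qed
    ultimately have "a2 * (\<beta> * (norm x)\<^sup>2 + (norm (L x - c))\<^sup>2) \<le> a2 * (\<beta> * s - p s)"
      by linarith
    then have "\<beta> * s - p s \<le> \<beta> * (norm x)\<^sup>2 + (norm (L x - c))\<^sup>2" using neg by simp
    then show "0 \<le> (norm (L x - c))\<^sup>2 + (a1 / a2) * ((norm x)\<^sup>2 - s) + (\<rho> * s - t) * (1 + s)"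
      by (simp add: \<beta>_def[symmetric] p_def right_diff_distrib)
  qed
qed

text \<open>
  This gives access to the values of a quadratic form on the hyperplane at infinity, where the
  homogenizing variable \<open>z3\<close> vanishes.
\<close>

lemma leading_coefficient_nonneg:
  fixes a b k :: real
  assumes "\<And>s. 0 \<le> a * s\<^sup>2 + b * s + k"
  shows "0 \<le> a"
proof (rule ccontr)
  assume "\<not> 0 \<le> a"
  then have a: "a < 0" by simp
  have k: "0 \<le> k" using assms[of 0] by simp
  define s where "s = sqrt ((k + 1) / - a)"
  have "s\<^sup>2 = (k + 1) / - a" using a k by (simp add: s_def divide_nonneg_neg)
  then have "a * s\<^sup>2 = - (k + 1)" using a by simp
  then show False using assms[of s] assms[of "- s"] by simp
qed

section \<open>The quadratic form of the block operator\<close>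

text \<open>
  The block operator is given through \<open>Blinfun\<close>, which is meaningful only for bounded linear maps;
  boundedness of the adjoint provides this.
\<close>

lemma block_op_apply:
  "blinfun_apply (block_op A b W \<rho> t \<alpha> \<beta>) (x, z1, z2, z3) =
     (\<alpha> *\<^sub>R adjoint A (W (A x)) + \<beta> *\<^sub>R x + z3 *\<^sub>R (- (\<alpha> *\<^sub>R adjoint A (W b))),
      ((1 - \<alpha>) / 2) * z3,
      \<rho> * z2 + ((\<rho> - t - \<beta>) / 2) * z3,
      x \<bullet> (- (\<alpha> *\<^sub>R adjoint A (W b))) + ((1 - \<alpha>) / 2) * z1 + ((\<rho> - t - \<beta>) / 2) * z2
        + (\<alpha> * (wnorm W b)\<^sup>2 - t) * z3)"
proof -
  have adj: "bounded_linear (\<lambda>p. adjoint A (W (A (fst p))))"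
    by (intro bounded_linear_compose[OF bounded_linear_adjoint_blinfun]
        bounded_linear_compose[OF blinfun.bounded_linear_right] bounded_linear_fst)
  have "bounded_linear (\<lambda>(x, z1, z2, z3).
     (\<alpha> *\<^sub>R adjoint A (W (A x)) + \<beta> *\<^sub>R x + z3 *\<^sub>R (- (\<alpha> *\<^sub>R adjoint A (W b))),
      ((1 - \<alpha>) / 2) * z3,
      \<rho> * z2 + ((\<rho> - t - \<beta>) / 2) * z3,
      x \<bullet> (- (\<alpha> *\<^sub>R adjoint A (W b))) + ((1 - \<alpha>) / 2) * z1 + ((\<rho> - t - \<beta>) / 2) * z2
        + (\<alpha> * (wnorm W b)\<^sup>2 - t) * z3))"
    unfolding case_prod_beta
    by (intro bounded_linear_Pair bounded_linear_add adj
        bounded_linear_const_scaleR bounded_linear_scaleR_const bounded_linear_const_mult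
        bounded_linear_inner_left_comp bounded_linear_fst
        bounded_linear_compose[OF bounded_linear_fst] bounded_linear_compose[OF bounded_linear_snd]
        bounded_linear_snd)
  then show ?thesis unfolding block_op_def by (simp add: bounded_linear_Blinfun_apply)
qed

lemma block_op_quadratic_form:
  assumes "psd_op W"
  shows "block_op A b W \<rho> t \<alpha> \<beta> (x, z1, z2, z3) \<bullet> (x, z1, z2, z3) =
    \<alpha> * (norm (sqrt_op W (A x) - z3 *\<^sub>R sqrt_op W b))\<^sup>2 + \<beta> * (norm x)\<^sup>2 - t * z3\<^sup>2
    + (1 - \<alpha>) * z1 * z3 + \<rho> * z2\<^sup>2 + (\<rho> - t - \<beta>) * z2 * z3"
proof -
  have adj: "adjoint A y \<bullet> x = y \<bullet> A x" "x \<bullet> adjoint A y = y \<bullet> A x" for y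
    using adjoint_blinfun[of x A y] by (simp_all add: inner_commute)
  have "W b \<bullet> A x = W (A x) \<bullet> b"
    using assms unfolding psd_op_def selfadjoint_op_def by (metis inner_commute)
  then have "(norm (sqrt_op W (A x) - z3 *\<^sub>R sqrt_op W b))\<^sup>2
      = W (A x) \<bullet> A x - 2 * z3 * (W b \<bullet> A x) + z3\<^sup>2 * (W b \<bullet> b)"
    unfolding power2_norm_eq_inner
    by (simp add: inner_simps sqrt_op_inner[OF assms] power2_eq_square algebra_simps)
  moreover have "(wnorm W b)\<^sup>2 = W b \<bullet> b"
    by (simp add: wnorm_def power2_norm_eq_inner sqrt_op_inner[OF assms])
  ultimately show ?thesis
    by (simp add: block_op_apply inner_simps adj power2_norm_eq_inner)
      (simp add: power2_eq_square algebra_simps)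
qed

theorem proposition4p13:
  fixes A :: "'h::{real_inner, complete_space} \<Rightarrow>\<^sub>L 'f::{real_inner, complete_space}"
    and b :: 'f and W :: "'f \<Rightarrow>\<^sub>L 'f" and \<rho> tstar :: real
  assumes "psd_op W"
    and "hilbert_schmidt (sqrt_op W)"
    and "\<rho> > 0"
    and "tstar = (INF x. objective A b W \<rho> x)"
  shows "tstar \<in> {t. \<exists>\<alpha> \<beta>. nonnegative_op (block_op A b W \<rho> t \<alpha> \<beta>)} \<and>
    (\<forall>t \<in> {t. \<exists>\<alpha> \<beta>. nonnegative_op (block_op A b W \<rho> t \<alpha> \<beta>)}. t \<le> tstar)"
proof -
  define L c where "L = sqrt_op W o\<^sub>L A" and "c = sqrt_op W b"
  note form = block_op_quadratic_form[OF assms(1), of A b \<rho>, folded c_def]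
  have obj: "objective A b W \<rho> x * (1 + (norm x)\<^sup>2)
      = (norm (L x - c))\<^sup>2 + \<rho> * (norm x)\<^sup>2 * (1 + (norm x)\<^sup>2)" for x
    by (simp add: objective_def wnorm_def L_def c_def blinfun.diff_right distrib_right
        add_pos_nonneg less_imp_neq[THEN not_sym])
  have pos: "0 < 1 + (norm x)\<^sup>2" for x :: 'h by (simp add: add_pos_nonneg)
  have bdd: "bdd_below (range (objective A b W \<rho>))"
    using assms(3) by (intro bdd_belowI2[where m = 0]) (simp add: objective_def)
  have "nonnegative_op (block_op A b W \<rho> tstar 1 \<beta>)"
    if \<beta>: "\<And>x s. 0 \<le> (norm (L x - c))\<^sup>2 + \<beta> * ((norm x)\<^sup>2 - s) + (\<rho> * s - tstar) * (1 + s)" for \<beta>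
  proof -
    have "0 \<le> block_op A b W \<rho> tstar 1 \<beta> (x, z1, z2, z3) \<bullet> (x, z1, z2, z3)" for x z1 z2 z3
    proof (cases "z3 = 0")
      case False
      \<comment> \<open>The form is homogeneous of degree two, which reduces this case to \<open>z3 = 1\<close>.\<close>
      let ?x = "(1 / z3) *\<^sub>R x" and ?s = "z2 / z3"
      have "L x - z3 *\<^sub>R c = z3 *\<^sub>R (L ?x - c)"
        using False by (simp add: blinfun.scaleR_right scaleR_diff_right)
      then have res: "(norm (L x - z3 *\<^sub>R c))\<^sup>2 = z3\<^sup>2 * (norm (L ?x - c))\<^sup>2"
        by (simp add: power_mult_distrib)
      have nx: "(norm x)\<^sup>2 = z3\<^sup>2 * (norm ?x)\<^sup>2" and s: "z2 = z3 * ?s"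
        using False by (simp_all add: power_mult_distrib power_divide)
      have "(norm (L x - z3 *\<^sub>R c))\<^sup>2 + \<beta> * (norm x)\<^sup>2 - tstar * z3\<^sup>2 + \<rho> * z2\<^sup>2
            + (\<rho> - tstar - \<beta>) * z2 * z3
          = z3\<^sup>2 * ((norm (L ?x - c))\<^sup>2 + \<beta> * ((norm ?x)\<^sup>2 - ?s) + (\<rho> * ?s - tstar) * (1 + ?s))"
        unfolding res nx by (subst (1 2) s) algebra
      also have "\<dots> \<ge> 0" using \<beta> by (intro mult_nonneg_nonneg zero_le_power2)
      finally show ?thesis by (simp add: form L_def)
    next
      case True
      \<comment> \<open>The value sought is the leading coefficient in \<open>s\<close> of the Lagrangian at \<open>(s x, s z2)\<close>.\<close>
      have "0 \<le> ((norm (L x))\<^sup>2 + \<beta> * (norm x)\<^sup>2 + \<rho> * z2\<^sup>2) * s\<^sup>2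
          + ((\<rho> - tstar - \<beta>) * z2 - 2 * (L x \<bullet> c)) * s + ((norm c)\<^sup>2 - tstar)" for s
      proof -
        have "(norm (L (s *\<^sub>R x) - c))\<^sup>2 = s\<^sup>2 * (norm (L x))\<^sup>2 - 2 * s * (L x \<bullet> c) + (norm c)\<^sup>2"
          unfolding power2_norm_eq_inner
          by (simp add: inner_simps inner_commute blinfun.scaleR_right power2_eq_square)
        moreover have "(norm (s *\<^sub>R x))\<^sup>2 = s\<^sup>2 * (norm x)\<^sup>2"
          by (simp add: power_mult_distrib)
        ultimately show ?thesis
          using \<beta>[of "s *\<^sub>R x" "s * z2"] by (simp add: algebra_simps power2_eq_square)
      qed
      then have "0 \<le> (norm (L x))\<^sup>2 + \<beta> * (norm x)\<^sup>2 + \<rho> * z2\<^sup>2"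
        by (rule leading_coefficient_nonneg)
      then show ?thesis using True by (simp add: form L_def)
    qed
    then show ?thesis by (auto simp: nonnegative_op_def)
  qed
  moreover obtain \<beta> where
    "\<And>x s. 0 \<le> (norm (L x - c))\<^sup>2 + \<beta> * ((norm x)\<^sup>2 - s) + (\<rho> * s - tstar) * (1 + s)"
  proof (rule multiplier_exists[of L \<rho> c tstar])
    show "linear L" using blinfun.bounded_linear_right bounded_linear.linear by blast
    show "0 \<le> (norm (L x - c))\<^sup>2 + (\<rho> * (norm x)\<^sup>2 - tstar) * (1 + (norm x)\<^sup>2)" for x
    proof -
      have "tstar \<le> objective A b W \<rho> x" unfolding assms(4) by (rule cINF_lower[OF bdd]) simp
      then have "tstar * (1 + (norm x)\<^sup>2) \<le> objective A b W \<rho> x * (1 + (norm x)\<^sup>2)"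
        using pos[of x] by (intro mult_right_mono) auto
      then show ?thesis unfolding obj by (simp add: left_diff_distrib)
    qed
  qed (use assms(3) in auto)
  moreover have "t \<le> tstar" if nn: "nonnegative_op (block_op A b W \<rho> t \<alpha> \<beta>)" for t \<alpha> \<beta>
  proof -
    have nn': "0 \<le> \<alpha> * (norm (L x - z3 *\<^sub>R c))\<^sup>2 + \<beta> * (norm x)\<^sup>2 - t * z3\<^sup>2
        + (1 - \<alpha>) * z1 * z3 + \<rho> * z2\<^sup>2 + (\<rho> - t - \<beta>) * z2 * z3" for x z1 z2 z3
    proof -
      have "0 \<le> block_op A b W \<rho> t \<alpha> \<beta> (x, z1, z2, z3) \<bullet> (x, z1, z2, z3)"
        using nn unfolding nonnegative_op_def by blast
      then show ?thesis unfolding form by (simp add: L_def)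
    qed
    have "\<alpha> = 1"
    proof (rule ccontr)
      assume "\<alpha> \<noteq> 1"
      then show False
        \<comment> \<open>This \<open>z1\<close> makes the form equal to \<open>- 1\<close> at \<open>x = 0\<close>, \<open>z2 = 0\<close>, \<open>z3 = 1\<close>.\<close>
        using nn'[of 0 1 "(- \<alpha> * (norm c)\<^sup>2 + t - 1) / (1 - \<alpha>)" 0] by simp
    qed
    have "t \<le> objective A b W \<rho> x" for x
    proof -
      have "0 \<le> (norm (L x - c))\<^sup>2 + (\<rho> * (norm x)\<^sup>2 - t) * (1 + (norm x)\<^sup>2)"
        using nn'[of x 1 0 "(norm x)\<^sup>2"] \<open>\<alpha> = 1\<close>
        by (simp add: algebra_simps power2_eq_square)
      then have "t * (1 + (norm x)\<^sup>2) \<le> objective A b W \<rho> x * (1 + (norm x)\<^sup>2)"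
        unfolding obj by (simp add: left_diff_distrib)
      then show ?thesis using pos[of x] by (simp add: mult_le_cancel_right_pos)
    qed
    then show ?thesis unfolding assms(4) by (intro cINF_greatest) auto
  qed
  ultimately show ?thesis by blast
qed

end
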